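(* Let $A,C,D,f\in\mathbb{C}$ and let $E$ be a negative integer. Then $$ {}_4F_3\left(\begin{matrix}C,\;D,\;E,\;f+1\\2+A,\;C+D+E-A,\;f\end{matrix}\right) =\frac{\Gamma(1+A)\Gamma(1+A-C-D)\Gamma(1+A-C-E)\Gamma(1+A-D-E)}{\Gamma(1+A-C)\Gamma(1+A-D)\Gamma(1+A-E)\Gamma(1+A-C-D-E)} $$ $$ \times\left(1-\frac{CDE(1+A-f)}{f(1+A-C)(1+A-D)(1+A-E)}\right). $$
   Context: ${}_pF_q$ denotes the generalized hypergeometric series evaluated at unit argument. Standing convention: lower parameters are never non-positive integers, denominators occurring do not vanish, and the Gamma functions occurring are not evaluated at poles. *)

theory Defs
  imports "HOL-Analysis.Analysis"
begin

(* fps_hypergeo as bs 1 has n-th coefficient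
   (prod_{a in as} (a)_n) / ((prod_{b in bs} (b)_n) * n!), including the factor n!. *)
definition hypergeo_F :: "complex list \<Rightarrow> complex list \<Rightarrow> complex \<Rightarrow> complex" where
  "hypergeo_F as bs z = eval_fps (fps_hypergeo as bs 1) z"

end

(* With p = 1 + A, the factor (f+1)_k/(f)_k = (f+k)/f equals (p+k)/p + k (p-f)/(p f).
   The summand p+k turns (p+1)_k into (p)_k, and the summand k shifts the summation index,
   so both parts are terminating Saalschuetzian 3F2 series. Multiplied by (c)_n (c-a-b)_n, Saalschuetz's
   theorem becomes a polynomial identity that holds in every commutative ring. *)
theory Submission
  imports Defs
begin

section \<open>Saalschuetz's theorem in polynomial form\<close>

text \<open>Induction on \<open>n\<close>: both sides gain the factor (c-a+n)(c-b+n) from n to n+1.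
  Where no denominator vanishes, the sum is (c)_n (c-a-b)_n times 3F2(a, b, -n; c,
  1+a+b-c-n).\<close>

lemma saalschuetz_pochhammer:
  fixes a b c :: "'a::comm_ring_1"
  shows "(\<Sum>k\<le>n. of_nat (n choose k) * pochhammer a k * pochhammer b k *
             pochhammer (c + of_nat k) (n - k) * pochhammer (c - a - b) (n - k)) =
         pochhammer (c - a) n * pochhammer (c - b) n"
proof (induction n)
  case 0
  show ?case by simp
next
  case (Suc n)
  define s where "s = c - a - b"
  define F where "F n k = of_nat (n choose k) * pochhammer a k * pochhammer b k *
      pochhammer (c + of_nat k) (n - k) * pochhammer s (n - k)" for n k
  define v where "v k = of_nat (n choose k) * pochhammer a (Suc k) * pochhammer b (Suc k) *
      pochhammer (c + of_nat (Suc k)) (n - k) * pochhammer s (n - k)" for k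
  \<comment> \<open>The Wilf--Zeilberger certificate: the recurrence in \<open>n\<close> holds termwise up to \<open>G (Suc k) - G k\<close>.\<close>
  define G where "G k = of_nat k * (s + of_nat n - of_nat k) * F n k" for k
  \<comment> \<open>Pascal's rule splits \<open>F (Suc n) (Suc k)\<close>: the part with
    \<open>n choose k\<close> is \<open>v k\<close>; the part with \<open>n choose Suc k\<close>,
    joined to the term at 0, differs from the sum of \<open>F n\<close> only in Pochhammer symbols
    longer by one, hence the two linear factors.\<close>
  have split_F: "(\<Sum>k\<le>Suc n. F (Suc n) k) =
      (\<Sum>k\<le>n. (c + of_nat n) * (s + of_nat n - of_nat k) * F n k + v k)"
  proof -
    have first: "of_nat (n choose k) * pochhammer a k * pochhammer b k *
        pochhammer (c + of_nat k) (Suc n - k) * pochhammer s (Suc n - k) =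
        (c + of_nat n) * (s + of_nat n - of_nat k) * F n k" if "k \<le> n" for k
      using that by (simp add: F_def Suc_diff_le pochhammer_rec' of_nat_diff algebra_simps)
    have "(\<Sum>k\<le>Suc n. F (Suc n) k) = F (Suc n) 0 + (\<Sum>k\<le>n. F (Suc n) (Suc k))"
      by (rule sum.atMost_Suc_shift)
    also have "(\<Sum>k\<le>n. F (Suc n) (Suc k)) = (\<Sum>k\<le>n. v k) +
        (\<Sum>k\<le>n. of_nat (n choose Suc k) * pochhammer a (Suc k) * pochhammer b (Suc k) *
          pochhammer (c + of_nat (Suc k)) (n - k) * pochhammer s (n - k))"
      by (simp add: F_def v_def sum.distrib [symmetric] distrib_right)
    also have "F (Suc n) 0 + \<dots> = (\<Sum>k\<le>n. v k) +
        (\<Sum>k\<le>Suc n. of_nat (n choose k) * pochhammer a k * pochhammer b k *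
          pochhammer (c + of_nat k) (Suc n - k) * pochhammer s (Suc n - k))"
      by (subst sum.atMost_Suc_shift) (simp add: F_def)
    also have "\<dots> = (\<Sum>k\<le>n. v k) +
        (\<Sum>k\<le>n. (c + of_nat n) * (s + of_nat n - of_nat k) * F n k)"
      by (simp add: first binomial_eq_0)
    finally show ?thesis by (simp add: sum.distrib)
  qed
  have telescope: "(c + of_nat n) * (s + of_nat n - of_nat k) * F n k + v k =
      (c - a + of_nat n) * (c - b + of_nat n) * F n k + (G (Suc k) - G k)" if "k \<le> n" for k
  proof (cases "k = n")
    case True
    have "v n = (a + of_nat n) * (b + of_nat n) * F n n"
      by (simp add: v_def F_def pochhammer_rec' algebra_simps)
    then show ?thesis
      by (simp add: True G_def F_def[of n "Suc n"] binomial_eq_0 s_def algebra_simps)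
  next
    case False
    with that obtain j where n: "n = Suc (k + j)"
      by (metis le_neq_implies_less less_imp_Suc_add)
    \<comment> \<open>A common factor of \<open>F n k\<close>, \<open>v k\<close> and
      \<open>G (Suc k)\<close>; pulling it out leaves a polynomial identity in a, b, c, k and j. It
      needs n-k = j+1, so \<open>k = n\<close> is treated apart.\<close>
    define w where "w = of_nat (n choose k) * pochhammer a k * pochhammer b k *
      pochhammer (c + of_nat (Suc k)) j * pochhammer s (Suc j)"
    have F: "F n k = (c + of_nat k) * w"
      by (simp add: F_def w_def n pochhammer_rec[of "c + of_nat k"] algebra_simps)
    have v: "v k = (a + of_nat k) * (b + of_nat k) * (c + of_nat n) * w"
    proof -
      have "pochhammer (c + of_nat (Suc k)) (n - k) =
          (c + of_nat n) * pochhammer (c + of_nat (Suc k)) j"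
        by (simp add: n pochhammer_rec' algebra_simps)
      then show ?thesis
        by (simp add: v_def w_def n pochhammer_rec'[of a] pochhammer_rec'[of b] mult_ac)
    qed
    \<comment> \<open>The factor \<open>of_nat k\<close> in \<open>G\<close> allows (k+1) C(n,k+1) =
      (n-k) C(n,k); the other factor, at k+1, is s+j and completes (s)_j to (s)_(j+1).\<close>
    have GS: "G (Suc k) = of_nat (Suc j) * (a + of_nat k) * (b + of_nat k) * w"
    proof -
      have "Suc k * (n choose Suc k) = Suc j * (n choose k)"
        using binomial_absorption[of k n] binomial_absorb_comp[of n k] n by simp
      then have ch: "of_nat (Suc k) * of_nat (n choose Suc k) =
          (of_nat (Suc j) * of_nat (n choose k) :: 'a)"
        by (simp only: flip: of_nat_mult)
      have "G (Suc k) = (of_nat (Suc k) * of_nat (n choose Suc k)) *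
          pochhammer a (Suc k) * pochhammer b (Suc k) *
          pochhammer (c + of_nat (Suc k)) j * ((s + of_nat j) * pochhammer s j)"
        by (simp add: G_def F_def n mult_ac del: binomial_Suc_Suc of_nat_Suc) (simp add: algebra_simps)
      also have "\<dots> = of_nat (Suc j) * (a + of_nat k) * (b + of_nat k) * w"
        unfolding ch w_def pochhammer_rec' by (simp only: mult_ac)
      finally show ?thesis .
    qed
    show ?thesis
      unfolding GS unfolding G_def[of k] F v by (simp add: n s_def algebra_simps)
  qed
  \<comment> \<open>Both boundary terms vanish: \<open>G 0\<close> by its factor k,
    \<open>G (Suc n)\<close> by the binomial coefficient.\<close>
  have G_sum: "(\<Sum>k\<le>n. G (Suc k) - G k) = 0"
    unfolding lessThan_Suc_atMost[symmetric] sum_lessThan_telescope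
    by (simp add: G_def F_def binomial_eq_0)
  have "(\<Sum>k\<le>Suc n. F (Suc n) k) =
      (\<Sum>k\<le>n. (c - a + of_nat n) * (c - b + of_nat n) * F n k + (G (Suc k) - G k))"
    unfolding split_F by (intro sum.cong refl telescope) simp
  also have "\<dots> = (c - a + of_nat n) * (c - b + of_nat n) * (\<Sum>k\<le>n. F n k)"
    by (simp only: sum.distrib G_sum sum_distrib_left add_0_right)
  also have "(\<Sum>k\<le>n. F n k) = pochhammer (c - a) n * pochhammer (c - b) n"
    using Suc.IH by (simp add: F_def s_def)
  finally show ?case
    by (simp add: F_def s_def pochhammer_rec' mult_ac)
qed

section \<open>The binomial sum with the extra factor f+k\<close>

text \<open>The term at 0 vanishes; the others obey absorption, (k+1) C(m+1,k+1) = (m+1)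
  C(m,k).\<close>

lemma sum_binomial_shift:
  fixes h :: "nat \<Rightarrow> 'a::comm_ring_1"
  shows "(\<Sum>k\<le>Suc m. of_nat k * (of_nat (Suc m choose k) * h k)) =
         of_nat (Suc m) * (\<Sum>k\<le>m. of_nat (m choose k) * h (Suc k))"
proof -
  have "of_nat (Suc k) * (of_nat (Suc m choose Suc k) * h (Suc k)) =
      of_nat (Suc m) * (of_nat (m choose k) * h (Suc k))" for k
    using Suc_times_binomial[of k m]
    by (simp only: mult.assoc[symmetric] of_nat_mult[symmetric])
  then show ?thesis
    by (subst sum.atMost_Suc_shift) (simp add: sum_distrib_left del: binomial_Suc_Suc of_nat_Suc)
qed

text \<open>\<open>U\<close> misses the balance of Saalschuetz's theorem by one: c = p+1 would
  require p+1-C-D in place of p-C-D. The splitting p(f+k) = f(p+k) + (p-f)k repairs this in each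
  part: the first lowers c to p, the second raises C and D by one and c to p+2.\<close>

lemma saalschuetz_4F3_pochhammer:
  fixes p C D f :: "'a::comm_ring_1" and m :: nat
  defines "U \<equiv> \<lambda>k. of_nat (Suc m choose k) * (pochhammer C k * pochhammer D k *
             pochhammer (p + 1 + of_nat k) (Suc m - k) * pochhammer (p - C - D) (Suc m - k))"
  shows "p * (\<Sum>k\<le>Suc m. (f + of_nat k) * U k) =
         f * (p + of_nat (Suc m)) * pochhammer (p - C) (Suc m) * pochhammer (p - D) (Suc m) +
         (p - f) * of_nat (Suc m) * C * D * pochhammer (p - C + 1) m * pochhammer (p - D + 1) m"
proof -
  have U: "(p + of_nat k) * U k = (p + of_nat (Suc m)) *
      (of_nat (Suc m choose k) * pochhammer C k * pochhammer D k *
       pochhammer (p + of_nat k) (Suc m - k) * pochhammer (p - C - D) (Suc m - k))"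
    if "k \<le> Suc m" for k
  proof -
    \<comment> \<open>The factor p+k extends the product (p+1+k)...(p+m+1) downwards; its last
      factor p+m+1, independent of k, is then split off.\<close>
    have "(p + of_nat k) * pochhammer (p + 1 + of_nat k) (Suc m - k) =
        pochhammer (p + of_nat k) (Suc (Suc m - k))"
      by (simp add: pochhammer_rec add_ac)
    also have "\<dots> = (p + of_nat (Suc m)) * pochhammer (p + of_nat k) (Suc m - k)"
      using that by (simp add: pochhammer_rec' of_nat_diff del: of_nat_Suc)
    finally have shift: "(p + of_nat k) * pochhammer (p + 1 + of_nat k) (Suc m - k) =
        (p + of_nat (Suc m)) * pochhammer (p + of_nat k) (Suc m - k)" .
    have "(p + of_nat k) * U k = of_nat (Suc m choose k) * pochhammer C k * pochhammer D k *
        ((p + of_nat k) * pochhammer (p + 1 + of_nat k) (Suc m - k)) *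
        pochhammer (p - C - D) (Suc m - k)"
      unfolding U_def by (simp only: mult_ac)
    then show ?thesis
      unfolding shift by (simp only: mult_ac)
  qed
  have S1: "(\<Sum>k\<le>Suc m. (p + of_nat k) * U k) =
      (p + of_nat (Suc m)) * (pochhammer (p - C) (Suc m) * pochhammer (p - D) (Suc m))"
    unfolding saalschuetz_pochhammer[symmetric] sum_distrib_left
    by (intro sum.cong refl U) simp
  have S2: "(\<Sum>k\<le>Suc m. of_nat k * U k) =
      of_nat (Suc m) * (C * D * (pochhammer (p - C + 1) m * pochhammer (p - D + 1) m))"
  proof -
    \<comment> \<open>With C+1, D+1 and c = p+2, the difference c-a-b is again p-C-D.\<close>
    have "(\<Sum>k\<le>m. of_nat (m choose k) * (pochhammer C (Suc k) * pochhammer D (Suc k) *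
        pochhammer (p + 1 + of_nat (Suc k)) (m - k) * pochhammer (p - C - D) (m - k))) =
      C * D * (\<Sum>k\<le>m. of_nat (m choose k) * pochhammer (C + 1) k * pochhammer (D + 1) k *
        pochhammer ((p + 2) + of_nat k) (m - k) * pochhammer ((p + 2) - (C + 1) - (D + 1)) (m - k))"
      unfolding sum_distrib_left
      by (intro sum.cong refl) (simp add: pochhammer_rec algebra_simps)
    also have "\<dots> = C * D * (pochhammer (p - C + 1) m * pochhammer (p - D + 1) m)"
      by (subst saalschuetz_pochhammer) (simp add: algebra_simps)
    finally show ?thesis
      unfolding U_def sum_binomial_shift by simp
  qed
  have "p * (\<Sum>k\<le>Suc m. (f + of_nat k) * U k) =
      f * (\<Sum>k\<le>Suc m. (p + of_nat k) * U k) + (p - f) * (\<Sum>k\<le>Suc m. of_nat k * U k)"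
    unfolding sum_distrib_left sum.distrib[symmetric]
    by (intro sum.cong refl) (simp add: algebra_simps)
  then show ?thesis
    unfolding S1 S2 by (simp only: mult_ac)
qed

section \<open>Terminating series as binomial sums\<close>

text \<open>Reversal gives (1-s-n)_k = (-1)^k (s)_n / (s)_(n-k); the sign cancels against (-n)_k =
  (-1)^k k! C(n,k), and (c)_n / (c)_k = (c+k)_(n-k).\<close>

lemma pochhammer_quotient_reverse:
  fixes c s :: "'a::field_char_0"
  assumes "k \<le> n" "pochhammer c n \<noteq> 0" "pochhammer s n \<noteq> 0"
  shows "pochhammer (- of_nat n) k / (pochhammer c k * pochhammer (1 - s - of_nat n) k * fact k) =
         of_nat (n choose k) * pochhammer (c + of_nat k) (n - k) * pochhammer s (n - k) /
         (pochhammer c n * pochhammer s n)"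
proof -
  have c: "pochhammer c n = pochhammer c k * pochhammer (c + of_nat k) (n - k)"
    using assms(1) by (rule pochhammer_product)
  have s: "pochhammer s n = pochhammer s (n - k) * pochhammer (s + of_nat n - of_nat k) k"
    using pochhammer_product[of "n - k" n s] assms(1) by (simp add: of_nat_diff algebra_simps)
  have "pochhammer (1 - s - of_nat n) k = pochhammer (- (s + of_nat n - 1)) k"
    by (simp add: algebra_simps)
  also have "\<dots> = (-1) ^ k * pochhammer (s + of_nat n - of_nat k) k"
    by (subst pochhammer_minus) (simp add: algebra_simps)
  finally have s': "pochhammer (1 - s - of_nat n) k =
      (-1) ^ k * pochhammer (s + of_nat n - of_nat k) k" .
  have b: "pochhammer (- of_nat n) k = (-1) ^ k * fact k * (of_nat (n choose k) :: 'a)"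
    by (simp add: binomial_gbinomial gbinomial_pochhammer)
  show ?thesis
    using assms(2,3) unfolding s' b c s by (simp add: field_simps)
qed

text \<open>The lower parameter has the form 1-s-n to permit this reversal; for c = p+1, s = p-C-D
  and n = m+1 the sum is that of \<open>saalschuetz_4F3_pochhammer\<close>.\<close>

lemma hypergeo_F_4_3_neg_nat:
  assumes "f \<notin> \<int>\<^sub>\<le>\<^sub>0" "pochhammer c n \<noteq> 0" "pochhammer s n \<noteq> 0"
  shows "hypergeo_F [C, D, - of_nat n, f + 1] [c, 1 - s - of_nat n, f] 1 =
         (\<Sum>k\<le>n. (f + of_nat k) * (of_nat (n choose k) * (pochhammer C k * pochhammer D k *
            pochhammer (c + of_nat k) (n - k) * pochhammer s (n - k)))) /
         (f * pochhammer c n * pochhammer s n)"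
proof -
  define T where "T k = fps_nth (fps_hypergeo [C, D, - of_nat n, f + 1] [c, 1 - s - of_nat n, f] 1) k" for k
  have T: "T k = pochhammer C k * pochhammer D k * (pochhammer (f + 1) k / pochhammer f k) *
      (pochhammer (- of_nat n) k / (pochhammer c k * pochhammer (1 - s - of_nat n) k * fact k))" for k
    by (simp add: T_def mult_ac)
  have ratio: "pochhammer (f + 1) k / pochhammer f k = (f + of_nat k) / f" for k
  proof -
    have "pochhammer f k \<noteq> 0" "f \<noteq> 0"
      using assms(1) by (auto simp: pochhammer_eq_0_iff)
    \<comment> \<open>Both sides are (f)_(k+1).\<close>
    moreover have "f * pochhammer (f + 1) k = (f + of_nat k) * pochhammer f k"
      using pochhammer_rec[of f k] pochhammer_rec'[of f k] by simp
    ultimately show ?thesis by (simp add: field_simps)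
  qed
  have "hypergeo_F [C, D, - of_nat n, f + 1] [c, 1 - s - of_nat n, f] 1 = (\<Sum>k. T k)"
    by (simp add: hypergeo_F_def eval_fps_def T_def del: fps_hypergeo_nth)
  \<comment> \<open>The series stops because (-n)_k = 0 for k > n.\<close>
  also have "\<dots> = (\<Sum>k\<le>n. T k)"
    by (rule suminf_finite) (auto simp: T pochhammer_of_nat_eq_0_iff)
  also have "\<dots> = (\<Sum>k\<le>n. (f + of_nat k) * (of_nat (n choose k) * (pochhammer C k * pochhammer D k *
      pochhammer (c + of_nat k) (n - k) * pochhammer s (n - k))) / (f * pochhammer c n * pochhammer s n))"
  proof (intro sum.cong refl)
    fix k assume "k \<in> {..n}"
    then have k: "k \<le> n" by simp
    show "T k = (f + of_nat k) * (of_nat (n choose k) * (pochhammer C k * pochhammer D k *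
        pochhammer (c + of_nat k) (n - k) * pochhammer s (n - k))) /
        (f * pochhammer c n * pochhammer s n)"
      unfolding T ratio pochhammer_quotient_reverse[OF k assms(2,3)] by (simp add: mult_ac)
  qed
  finally show ?thesis by (simp add: sum_divide_distrib)
qed

section \<open>Evaluation by Gamma functions\<close>

theorem mainTheorem17:
  fixes A C D f :: complex and E :: int
  assumes "E < 0"
    and "2 + A \<notin> \<int>\<^sub>\<le>\<^sub>0"
    and "C + D + of_int E - A \<notin> \<int>\<^sub>\<le>\<^sub>0"
    and "f \<notin> \<int>\<^sub>\<le>\<^sub>0"
    and "1 + A \<notin> \<int>\<^sub>\<le>\<^sub>0"
    and "1 + A - C - D \<notin> \<int>\<^sub>\<le>\<^sub>0"
    and "1 + A - C - of_int E \<notin> \<int>\<^sub>\<le>\<^sub>0"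
    and "1 + A - D - of_int E \<notin> \<int>\<^sub>\<le>\<^sub>0"
    and "1 + A - C \<notin> \<int>\<^sub>\<le>\<^sub>0"
    and "1 + A - D \<notin> \<int>\<^sub>\<le>\<^sub>0"
    and "1 + A - of_int E \<notin> \<int>\<^sub>\<le>\<^sub>0"
    and "1 + A - C - D - of_int E \<notin> \<int>\<^sub>\<le>\<^sub>0"
  shows "hypergeo_F [C, D, of_int E, f + 1] [2 + A, C + D + of_int E - A, f] 1 =
    (Gamma (1 + A) * Gamma (1 + A - C - D) * Gamma (1 + A - C - of_int E) * Gamma (1 + A - D - of_int E)) /
    (Gamma (1 + A - C) * Gamma (1 + A - D) * Gamma (1 + A - of_int E) * Gamma (1 + A - C - D - of_int E)) *
    (1 - (C * D * of_int E * (1 + A - f)) /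
         (f * (1 + A - C) * (1 + A - D) * (1 + A - of_int E)))"
proof -
  \<comment> \<open>E = -(m+1), so that the index-shifted sum has order m.\<close>
  define m where "m = nat (- E - 1)"
  have E: "(of_int E :: complex) = - of_nat (Suc m)"
    using assms(1) by (simp add: m_def of_nat_nat)
  define p where "p = 1 + A"
  \<comment> \<open>This choice makes C+D+E-A equal to 1-s-(m+1).\<close>
  define s where "s = p - C - D"
  have p: "p \<notin> \<int>\<^sub>\<le>\<^sub>0" and s: "s \<notin> \<int>\<^sub>\<le>\<^sub>0"
    and pC: "p - C \<notin> \<int>\<^sub>\<le>\<^sub>0" and pD: "p - D \<notin> \<int>\<^sub>\<le>\<^sub>0"
    using assms by (simp_all add: p_def s_def)
  have poch_nz: "pochhammer z n \<noteq> 0" if "z \<notin> \<int>\<^sub>\<le>\<^sub>0" for z :: complex and n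
    using that by (auto simp: pochhammer_eq_0_iff)
  have p1: "p + 1 \<notin> \<int>\<^sub>\<le>\<^sub>0"
    using assms(2) by (simp add: p_def add_ac)
  have nz: "p \<noteq> 0" "p - C \<noteq> 0" "p - D \<noteq> 0" "f \<noteq> 0"
    using p pC pD assms(4) by auto
  have pn: "p + of_nat (Suc m) \<noteq> 0"
    using assms(11) by (auto simp: p_def E simp del: of_nat_Suc)
  have C1: "pochhammer (p - C) (Suc m) = (p - C) * pochhammer (p - C + 1) m"
    and D1: "pochhammer (p - D) (Suc m) = (p - D) * pochhammer (p - D + 1) m"
    and P1: "p * pochhammer (p + 1) (Suc m) = (p + of_nat (Suc m)) * pochhammer p (Suc m)"
    using pochhammer_rec[of p "Suc m"] pochhammer_rec'[of p "Suc m"]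
    by (simp_all add: pochhammer_rec)
  define S where "S = (\<Sum>k\<le>Suc m. (f + of_nat k) * (of_nat (Suc m choose k) *
      (pochhammer C k * pochhammer D k * pochhammer (p + 1 + of_nat k) (Suc m - k) *
       pochhammer s (Suc m - k))))"
  define X where "X = pochhammer (p - C) (Suc m) * pochhammer (p - D) (Suc m)"
  define Z where "Z = 1 + C * D * of_nat (Suc m) * (p - f) /
      (f * (p - C) * (p - D) * (p + of_nat (Suc m)))"
  \<comment> \<open>The last quotient is (p-C+1)_m (p-D+1)_m.\<close>
  have "p * S = f * (p + of_nat (Suc m)) * X +
      (p - f) * of_nat (Suc m) * C * D * (X / ((p - C) * (p - D)))"
    unfolding S_def s_def saalschuetz_4F3_pochhammer X_def C1 D1 using nz by (simp add: mult_ac)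
  also have "\<dots> = f * (p + of_nat (Suc m)) * X * Z"
    using nz pn unfolding Z_def by (simp add: divide_simps del: of_nat_Suc) (simp add: algebra_simps del: of_nat_Suc)
  finally have S: "p * S = f * (p + of_nat (Suc m)) * X * Z" .
  have "hypergeo_F [C, D, of_int E, f + 1] [2 + A, C + D + of_int E - A, f] 1 =
      hypergeo_F [C, D, - of_nat (Suc m), f + 1] [p + 1, 1 - s - of_nat (Suc m), f] 1"
    by (simp add: E p_def s_def algebra_simps)
  also have "\<dots> = S / (f * pochhammer (p + 1) (Suc m) * pochhammer s (Suc m))"
    unfolding S_def by (rule hypergeo_F_4_3_neg_nat) (use assms(4) poch_nz p1 s in auto)
  \<comment> \<open>Expanding by p turns (p+1)_(m+1) into (p+m+1) (p)_(m+1), whose factor p+m+1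
    cancels the one in \<open>p * S\<close>.\<close>
  also have "\<dots> = (p * S) / (f * (p * pochhammer (p + 1) (Suc m)) * pochhammer s (Suc m))"
    using nz by simp
  also have "\<dots> = X / (pochhammer p (Suc m) * pochhammer s (Suc m)) * Z"
    unfolding S P1 using nz pn by (simp del: of_nat_Suc)
  \<comment> \<open>(z)_n = Gamma(z+n)/Gamma(z) at z = p, s, p-C, p-D.\<close>
  also have "X / (pochhammer p (Suc m) * pochhammer s (Suc m)) =
      (Gamma p * Gamma s * Gamma (p - C + of_nat (Suc m)) * Gamma (p - D + of_nat (Suc m))) /
      (Gamma (p - C) * Gamma (p - D) * Gamma (p + of_nat (Suc m)) * Gamma (s + of_nat (Suc m)))"
    unfolding X_def pochhammer_Gamma[OF p] pochhammer_Gamma[OF s]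
      pochhammer_Gamma[OF pC] pochhammer_Gamma[OF pD]
    by (simp add: mult_ac del: of_nat_Suc)
  finally have result: "hypergeo_F [C, D, of_int E, f + 1] [2 + A, C + D + of_int E - A, f] 1 =
      (Gamma p * Gamma s * Gamma (p - C + of_nat (Suc m)) * Gamma (p - D + of_nat (Suc m))) /
      (Gamma (p - C) * Gamma (p - D) * Gamma (p + of_nat (Suc m)) * Gamma (s + of_nat (Suc m))) * Z" .
  have "p - C + of_nat (Suc m) = 1 + A - C - of_int E" "p - D + of_nat (Suc m) = 1 + A - D - of_int E"
    "p + of_nat (Suc m) = 1 + A - of_int E" "s + of_nat (Suc m) = 1 + A - C - D - of_int E"
    by (simp_all add: E p_def s_def)
  moreover have "Z = 1 - (C * D * of_int E * (1 + A - f)) /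
      (f * (1 + A - C) * (1 + A - D) * (1 + A - of_int E))"
    by (simp add: Z_def E p_def del: of_nat_Suc)
  ultimately show ?thesis
    using result by (simp only: p_def s_def)
qed

end
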